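(* Under the standing assumptions, no transaction DAG produced by the ABC protocol contains a pair of confirmed transactions that conflict.
   Context: ABC is a cryptocurrency protocol. An output is a pair (value, owner public key). A transaction $t$ has a set of inputs (outputs of earlier transactions, which $t$ spends), a set of outputs with the same total value, and a validator public key; it is signed by its inputs' secret keys. The genesis is an input-less transaction with output values summing to $M$, confirmed from the start. An ack is a validator-signed message containing a reference to the previous ack of the same validator and references to a set of transactions it signs. Messages reference only earlier messages and form a DAG rooted at genesis. $\mathrm{past}(x)$ is the set of messages reachable from $x$ by following references; $\mathrm{past}(A)=\bigcup_{x\in A}\mathrm{past}(x)$. The stake delegated to validator $v$ in $\mathrm{past}(A)$ (for a set of acks $A$) is the sum of the values of outputs, unspent in $\mathrm{past}(A)$, of transactions confirmed in $\mathrm{past}(A)$ that indicate $v$ as validator. A transaction $t$ is confirmed if the transactions producing its inputs are confirmed and there exists a set of acks $A_t$ such that the validators signing $t$ in $A_t$ have total delegated stake in $\mathrm{past}(A_t)$ strictly exceeding $\tfrac23 M$, and no other transaction in $\mathrm{past}(A_t)$ shares an input with $t$. Dependence: $t'$ depends on $t$ if $t'$ spends an output of $t$, closed reflexively and transitively. Conflict: two transactions spending the same output conflict; if $t_1,t_2$ conflict then every transaction depending on $t_1$ conflicts with every transaction depending on $t_2$. Standing assumptions: honest validators reference their own previous ack in every new ack and never sign two transactions sharing an input; honest agents never spend an output twice; the adversary behaves arbitrarily and controls message delivery (messages are eventually delivered, no timing bound); at all times the stake delegated to the adversary is less than $M/3$: genesis outputs delegated to adversarial validators sum to less than $M/3$,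 a transaction delegated to an honest validator decreases the adversary's count by the value of its adversary-delegated inputs when it is confirmed, and a transaction delegated to the adversary increases the count by the value of its honest-delegated inputs when it is issued. *)

theory Defs
  imports Complex_Main
begin

text \<open>An execution is modelled as the finite list of all messages issued so far, in the
global order of issuance: message i is ms ! i and a message refers to earlier messages by
their index.  Index 0 is the genesis.  An output is identified by the pair (i, k): the k-th
output of the transaction with index i.  Public keys have type 'pk.  Every output carries
(value, owner key, validator key); for an ordinary transaction the validator of each output
is the validator key of the transaction, for the genesis each output indicates its own
validator.\<close>

datatype 'pk msg =
    Genesis "(real \<times> 'pk \<times> 'pk) list"            \<comment> \<open>outputs: (value, owner, validator)\<close>
  | Tx "(nat \<times> nat) set" "(real \<times> 'pk) list" 'pk  \<comment> \<open>inputs, outputs (value, owner), validator\<close>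
  | Ack 'pk "nat option" "nat set"                  \<comment> \<open>signer, previous ack, signed transactions\<close>

fun outs_of :: "'pk msg \<Rightarrow> (real \<times> 'pk \<times> 'pk) list" where
  "outs_of (Genesis os) = os"
| "outs_of (Tx I os v) = map (\<lambda>(a, w). (a, w, v)) os"
| "outs_of (Ack v p T) = []"

fun ins_of :: "'pk msg \<Rightarrow> (nat \<times> nat) set" where
  "ins_of (Genesis os) = {}"
| "ins_of (Tx I os v) = I"
| "ins_of (Ack v p T) = {}"

fun refs_of :: "'pk msg \<Rightarrow> nat set" where
  "refs_of (Genesis os) = {}"
| "refs_of (Tx I os v) = fst ` I"
| "refs_of (Ack v p T) = set_option p \<union> T"

fun is_txm :: "'pk msg \<Rightarrow> bool" where
  "is_txm (Genesis os) = True"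
| "is_txm (Tx I os v) = True"
| "is_txm (Ack v p T) = False"

fun is_ackm :: "'pk msg \<Rightarrow> bool" where
  "is_ackm (Ack v p T) = True"
| "is_ackm _ = False"

definition is_tx :: "'pk msg list \<Rightarrow> nat \<Rightarrow> bool" where
  "is_tx ms i \<longleftrightarrow> i < length ms \<and> is_txm (ms ! i)"

definition is_ack :: "'pk msg list \<Rightarrow> nat \<Rightarrow> bool" where
  "is_ack ms i \<longleftrightarrow> i < length ms \<and> is_ackm (ms ! i)"

definition ack_by :: "'pk msg list \<Rightarrow> 'pk \<Rightarrow> nat \<Rightarrow> bool" where
  "ack_by ms v i \<longleftrightarrow> i < length ms \<and> (\<exists>p T. ms ! i = Ack v p T)"

definition ins :: "'pk msg list \<Rightarrow> nat \<Rightarrow> (nat \<times> nat) set" where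
  "ins ms i = (if i < length ms then ins_of (ms ! i) else {})"

definition is_output :: "'pk msg list \<Rightarrow> nat \<times> nat \<Rightarrow> bool" where
  "is_output ms u \<longleftrightarrow> fst u < length ms \<and> snd u < length (outs_of (ms ! fst u))"

definition out_val :: "'pk msg list \<Rightarrow> nat \<times> nat \<Rightarrow> real" where
  "out_val ms u = fst (outs_of (ms ! fst u) ! snd u)"

definition out_owner :: "'pk msg list \<Rightarrow> nat \<times> nat \<Rightarrow> 'pk" where
  "out_owner ms u = fst (snd (outs_of (ms ! fst u) ! snd u))"

definition out_del :: "'pk msg list \<Rightarrow> nat \<times> nat \<Rightarrow> 'pk" where
  "out_del ms u = snd (snd (outs_of (ms ! fst u) ! snd u))"

definition ref_rel :: "'pk msg list \<Rightarrow> (nat \<times> nat) set" where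
  "ref_rel ms = {(a, b). a < length ms \<and> b \<in> refs_of (ms ! a)}"

definition past :: "'pk msg list \<Rightarrow> nat set \<Rightarrow> nat set" where
  "past ms X = {j. \<exists>x\<in>X. x < length ms \<and> (x, j) \<in> (ref_rel ms)\<^sup>*}"

definition signers :: "'pk msg list \<Rightarrow> nat set \<Rightarrow> nat \<Rightarrow> 'pk set" where
  "signers ms A t = {v. \<exists>a\<in>A. a < length ms \<and> (\<exists>p T. ms ! a = Ack v p T \<and> t \<in> T)}"

text \<open>Stake delegated to v in the set of messages P, where C is the set of transactions
confirmed in P: sum of the values of outputs, unspent in P, of transactions in C \<inter> P
indicating v as validator.\<close>

definition spent_in :: "'pk msg list \<Rightarrow> nat set \<Rightarrow> nat \<times> nat \<Rightarrow> bool" where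
  "spent_in ms P u \<longleftrightarrow> (\<exists>j\<in>P. u \<in> ins ms j)"

definition stake :: "'pk msg list \<Rightarrow> nat set \<Rightarrow> nat set \<Rightarrow> 'pk \<Rightarrow> real" where
  "stake ms C P v =
     (\<Sum>u \<in> {u. is_output ms u \<and> fst u \<in> P \<and> fst u \<in> C \<and> out_del ms u = v \<and> \<not> spent_in ms P u}.
        out_val ms u)"

text \<open>Confirmation of transaction t in the sub-DAG D (a set of message indices).
Inductive (least) definition: the genesis is confirmed from the start; otherwise the
producers of its inputs must be confirmed in D and there must be a set of acks A in D such
that the validators signing t in A have total stake in past(A) (computed w.r.t. the
transactions confirmed in past(A)) strictly exceeding 2/3 M, and no other transaction in
past(A) shares an input with t.  Since stake is monotone in the set of confirmed
transactions (values are nonnegative), quantifying over a set C of transactions confirmed in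
past(A) is the same as using all of them; this form keeps the definition monotone.\<close>

definition total :: "'pk msg list \<Rightarrow> real" where
  "total ms = (\<Sum>x\<leftarrow>outs_of (ms ! 0). fst x)"

inductive conf :: "'pk msg list \<Rightarrow> nat set \<Rightarrow> nat \<Rightarrow> bool" for ms where
  genesis: "0 \<in> D \<Longrightarrow> 0 < length ms \<Longrightarrow> conf ms D 0"
| step: "\<lbrakk> t \<in> D; is_tx ms t;
           \<forall>p \<in> fst ` ins ms t. conf ms D p;
           finite A; A \<subseteq> D; \<forall>a\<in>A. is_ack ms a;
           \<forall>c\<in>C. conf ms (past ms A) c;
           (\<Sum>v\<in>signers ms A t. stake ms C (past ms A) v) > 2/3 * total ms;
           \<forall>j\<in>past ms A. is_tx ms j \<and> j \<noteq> t \<longrightarrow> ins ms j \<inter> ins ms t = {} \<rbrakk>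
         \<Longrightarrow> conf ms D t"

definition confirmed :: "'pk msg list \<Rightarrow> nat \<Rightarrow> bool" where
  "confirmed ms t \<longleftrightarrow> conf ms {..<length ms} t"

definition depends :: "'pk msg list \<Rightarrow> nat \<Rightarrow> nat \<Rightarrow> bool" where
  "depends ms t' t \<longleftrightarrow> (t', t) \<in> {(a, b). b \<in> fst ` ins ms a}\<^sup>*"

inductive conflict :: "'pk msg list \<Rightarrow> nat \<Rightarrow> nat \<Rightarrow> bool" for ms where
  base: "\<lbrakk> is_tx ms t1; is_tx ms t2; t1 \<noteq> t2; ins ms t1 \<inter> ins ms t2 \<noteq> {} \<rbrakk> \<Longrightarrow> conflict ms t1 t2"
| dep: "\<lbrakk> conflict ms t1 t2; is_tx ms t1'; is_tx ms t2'; depends ms t1' t1; depends ms t2' t2 \<rbrakk>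
         \<Longrightarrow> conflict ms t1' t2'"

definition wf_dag :: "'pk msg list \<Rightarrow> bool" where
  "wf_dag ms \<longleftrightarrow>
     ms \<noteq> [] \<and> (\<exists>os. ms ! 0 = Genesis os)
   \<and> (\<forall>i < length ms. \<forall>os. i \<noteq> 0 \<longrightarrow> ms ! i \<noteq> Genesis os)
   \<and> (\<forall>i < length ms. \<forall>x \<in> set (outs_of (ms ! i)). fst x \<ge> 0)
   \<and> (\<forall>i < length ms. \<forall>I os v. ms ! i = Tx I os v \<longrightarrow>
          finite I \<and> I \<noteq> {}
        \<and> (\<forall>u \<in> I. fst u < i \<and> is_txm (ms ! fst u) \<and> is_output ms u)
        \<and> (\<Sum>u\<in>I. out_val ms u) = (\<Sum>x\<leftarrow>os. fst x))
   \<and> (\<forall>i < length ms. \<forall>v p T. ms ! i = Ack v p T \<longrightarrow>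
          (\<forall>j. p = Some j \<longrightarrow> j < i \<and> ack_by ms v j)
        \<and> (\<forall>t \<in> T. t < i \<and> is_txm (ms ! t)))
   \<and> (\<forall>i < length ms. 0 \<in> past ms {i})"

text \<open>Honest agents (owners of keys in Hon) never spend an output twice; transactions are
signed by the secret keys of their inputs, so no one else can spend an honest output.\<close>

definition honest_agents :: "'pk set \<Rightarrow> 'pk msg list \<Rightarrow> bool" where
  "honest_agents Hon ms \<longleftrightarrow>
     (\<forall>u i j. i < length ms \<and> j < length ms \<and> i \<noteq> j \<and> u \<in> ins ms i \<and> u \<in> ins ms j
        \<longrightarrow> out_owner ms u \<notin> Hon)"

definition honest_validators :: "'pk set \<Rightarrow> 'pk msg list \<Rightarrow> bool" where
  "honest_validators Hon ms \<longleftrightarrow>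
     (\<forall>i < length ms. \<forall>v p T. ms ! i = Ack v p T \<and> v \<in> Hon \<longrightarrow>
        p = (if \<exists>j < i. ack_by ms v j then Some (GREATEST j. j < i \<and> ack_by ms v j) else None))
   \<and> (\<forall>v \<in> Hon. \<forall>a b t1 t2 p1 p2 T1 T2.
        a < length ms \<and> b < length ms \<and> ms ! a = Ack v p1 T1 \<and> ms ! b = Ack v p2 T2
        \<and> t1 \<in> T1 \<and> t2 \<in> T2 \<and> t1 \<noteq> t2 \<longrightarrow> ins ms t1 \<inter> ins ms t2 = {})"

definition adv_count :: "'pk set \<Rightarrow> 'pk msg list \<Rightarrow> nat \<Rightarrow> real" where
  "adv_count Hon ms n =
     (\<Sum>x\<leftarrow>outs_of (ms ! 0). if snd (snd x) \<notin> Hon then fst x else 0)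
   + (\<Sum>i\<in>{i. i < n \<and> (\<exists>I os v. ms ! i = Tx I os v \<and> v \<notin> Hon)}.
        \<Sum>u\<in>{u \<in> ins ms i. out_del ms u \<in> Hon}. out_val ms u)
   - (\<Sum>i\<in>{i. i < n \<and> (\<exists>I os v. ms ! i = Tx I os v \<and> v \<in> Hon) \<and> conf ms {..<n} i}.
        \<Sum>u\<in>{u \<in> ins ms i. out_del ms u \<notin> Hon}. out_val ms u)"

definition adv_bound :: "'pk set \<Rightarrow> 'pk msg list \<Rightarrow> bool" where
  "adv_bound Hon ms \<longleftrightarrow> (\<forall>n \<le> length ms. adv_count Hon ms n < total ms / 3)"

end

theory Submission
  imports Defs "HOL-Library.Product_Lexorder"
begin

text \<open>
Call (t, A) a certificate if A witnesses the confirmation of t.  The key fact is that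
certificates are linearly ordered: for certificates (t1, A1) and (t2, A2), t1 lies in past(A2)
or t2 lies in past(A1).  As no competitor of t1 lies in past(A1), this excludes two confirmed
transactions sharing an input, and conflicts reduce to that case because all ancestors of a
confirmed transaction are confirmed.

Take a minimal counterexample to the key fact.  An honest validator signing both t1 and t2 would
order them through its chain of acks, so the two quorums share only adversarial validators.  By
minimality, everything counted as confirmed in past(A1) or past(A2) lies in both pasts and is free
of double spending, so the outputs backing the two quorums are unspent outputs of one ledger
of total value M.  Each quorum exceeds 2M/3, so more than M/3 is counted by both, and
all of this is delegated to the adversary.  Let c be the latest transaction producing such an
output.  The adversary's count just after c was issued is below M/3, so some transaction r
confirmed by then has spent one of these outputs.  By minimality r and c are ordered; r was
confirmed before c could be acknowledged, so r lies in the past of the certificate of c, and the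
output was already spent in past(A1), a contradiction.
\<close>

section \<open>Ledgers, certificates and the order between them\<close>

definition outputs :: "'pk msg list \<Rightarrow> nat set \<Rightarrow> (nat \<times> nat) set" where
  "outputs ms X = {u. is_output ms u \<and> fst u \<in> X}"

definition unspent :: "'pk msg list \<Rightarrow> nat set \<Rightarrow> (nat \<times> nat) set" where
  "unspent ms X = outputs ms X - (\<Union>i\<in>X. ins ms i)"

definition input_closed :: "'pk msg list \<Rightarrow> nat set \<Rightarrow> bool" where
  "input_closed ms X \<longleftrightarrow> (\<forall>i\<in>X. fst ` ins ms i \<subseteq> X)"

definition conflict_free :: "'pk msg list \<Rightarrow> nat set \<Rightarrow> bool" where
  "conflict_free ms X \<longleftrightarrow> (\<forall>i\<in>X. \<forall>j\<in>X. i \<noteq> j \<longrightarrow> ins ms i \<inter> ins ms j = {})"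

text \<open>\<open>K = UNIV\<close> gives the full value and \<open>K = - Hon\<close> the value
  delegated to the adversary, so one accounting of unspent outputs serves both.\<close>

definition val_in :: "'pk msg list \<Rightarrow> 'pk set \<Rightarrow> nat \<times> nat \<Rightarrow> real" where
  "val_in ms K u = (if out_del ms u \<in> K then out_val ms u else 0)"

text \<open>The rank bounds the nesting depth of the certificates used to evaluate stakes.  It is
needed for well-foundedness, as a certificate A may serve to confirm transactions that are counted
in the stake of A itself.\<close>

fun cert :: "'pk msg list \<Rightarrow> nat \<Rightarrow> nat \<Rightarrow> nat set \<Rightarrow> bool" where
  "cert ms 0 t A \<longleftrightarrow> False"
| "cert ms (Suc k) t A \<longleftrightarrow>
     is_tx ms t \<and> (\<forall>a\<in>A. is_ack ms a)
   \<and> (\<forall>j\<in>past ms A. is_tx ms j \<and> j \<noteq> t \<longrightarrow> ins ms j \<inter> ins ms t = {})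
   \<and> (\<exists>C. input_closed ms C \<and> (\<forall>c\<in>C. c = 0 \<or> (\<exists>A'\<subseteq>past ms A. cert ms k c A'))
        \<and> (\<Sum>v\<in>signers ms A t. stake ms C (past ms A) v) > 2/3 * total ms)"

text \<open>The weight of a certificate is a pair (bound on the ack indices, rank), ordered
lexicographically: certificates in an earlier prefix of the execution are smaller whatever
their rank.\<close>

definition bounded_cert :: "'pk msg list \<Rightarrow> nat \<times> nat \<Rightarrow> nat \<Rightarrow> nat set \<Rightarrow> bool" where
  "bounded_cert ms w t A \<longleftrightarrow> A \<subseteq> {..<fst w} \<and> cert ms (snd w) t A"

definition ordered_at :: "'pk msg list \<Rightarrow> nat \<times> nat \<Rightarrow> nat \<times> nat \<Rightarrow> bool" where
  "ordered_at ms w1 w2 \<longleftrightarrow> (\<forall>t1 A1 t2 A2.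
     bounded_cert ms w1 t1 A1 \<longrightarrow> bounded_cert ms w2 t2 A2 \<longrightarrow> t1 \<in> past ms A2 \<or> t2 \<in> past ms A1)"

section \<open>Basic facts on ranked certificates, pasts and dependence\<close>

lemma ordered_atD:
  "ordered_at ms w1 w2 \<Longrightarrow> bounded_cert ms w1 t1 A1 \<Longrightarrow> bounded_cert ms w2 t2 A2
    \<Longrightarrow> t1 \<in> past ms A2 \<or> t2 \<in> past ms A1"
  unfolding ordered_at_def by blast

lemma certI:
  assumes "is_tx ms t" "\<forall>a\<in>A. is_ack ms a"
    "\<forall>j\<in>past ms A. is_tx ms j \<and> j \<noteq> t \<longrightarrow> ins ms j \<inter> ins ms t = {}"
    "input_closed ms C" "\<forall>c\<in>C. c = 0 \<or> (\<exists>A'\<subseteq>past ms A. cert ms k c A')"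
    "(\<Sum>v\<in>signers ms A t. stake ms C (past ms A) v) > 2/3 * total ms"
  shows "cert ms (Suc k) t A"
  by (subst cert.simps(2), intro conjI exI[of _ C]) (use assms in simp_all)

lemma cert_Suc: "cert ms k t A \<Longrightarrow> cert ms (Suc k) t A"
proof (induction k arbitrary: t A)
  case (Suc k)
  from Suc.prems obtain C where C: "input_closed ms C"
    "\<forall>c\<in>C. c = 0 \<or> (\<exists>A'\<subseteq>past ms A. cert ms k c A')"
    "(\<Sum>v\<in>signers ms A t. stake ms C (past ms A) v) > 2/3 * total ms" by auto
  have "\<forall>c\<in>C. c = 0 \<or> (\<exists>A'\<subseteq>past ms A. cert ms (Suc k) c A')"
    using C(2) Suc.IH by meson
  with C(1,3) show ?case using Suc.prems by (intro certI) auto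
qed simp

lemma cert_mono: "k \<le> k' \<Longrightarrow> cert ms k t A \<Longrightarrow> cert ms k' t A"
  by (induction rule: dec_induct) (use cert_Suc in blast)+

text \<open>Gives a common rank to finitely many transactions certified separately: the sum of the
  individual ranks bounds each of them.\<close>

lemma bounded_uniform:
  fixes P :: "'a \<Rightarrow> nat \<Rightarrow> bool"
  assumes "finite C" "\<forall>c\<in>C. \<exists>k. P c k" "\<And>c k k'. k \<le> k' \<Longrightarrow> P c k \<Longrightarrow> P c k'"
  shows "\<exists>k. \<forall>c\<in>C. P c k"
proof -
  obtain f where f: "\<forall>c\<in>C. P c (f c)" using assms(2) by metis
  have "\<forall>c\<in>C. P c (sum f C)"
    using f assms(3) member_le_sum[OF _ _ assms(1), of _ f] by blast
  then show ?thesis ..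
qed

lemma past_mono: "A \<subseteq> past ms B \<Longrightarrow> past ms A \<subseteq> past ms B"
  unfolding past_def by (blast intro: rtrancl_trans)

lemma past_self: "a \<in> A \<Longrightarrow> a < length ms \<Longrightarrow> a \<in> past ms A"
  unfolding past_def by blast

lemma signer_past: "v \<in> signers ms A t \<Longrightarrow> t \<in> past ms A"
  unfolding signers_def past_def ref_rel_def by (fastforce intro!: r_into_rtrancl)

lemma depends_refl: "depends ms t t"
  by (simp add: depends_def)

lemma depends_trans: "depends ms t s \<Longrightarrow> depends ms s r \<Longrightarrow> depends ms t r"
  unfolding depends_def by (rule rtrancl_trans)

text \<open>Rule \<open>dep\<close> only extends the dependency chains, so transitivity absorbs it
  and every conflict goes back to a genuine double spend.\<close>

lemma conflict_base:
  assumes "conflict ms t1 t2"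
  obtains s1 s2 where "depends ms t1 s1" "depends ms t2 s2" "s1 \<noteq> s2" "ins ms s1 \<inter> ins ms s2 \<noteq> {}"
proof -
  have "\<exists>s1 s2. depends ms t1 s1 \<and> depends ms t2 s2 \<and> s1 \<noteq> s2 \<and> ins ms s1 \<inter> ins ms s2 \<noteq> {}"
    using assms
  proof induction
    case (base t1 t2)
    then show ?case using depends_refl by blast
  next
    case (dep t1 t2 t1' t2')
    then show ?case using depends_trans by blast
  qed
  then show thesis using that by blast
qed

lemma input_closed_depends:
  assumes "input_closed ms X" "depends ms t s" "t \<in> X"
  shows "s \<in> X"
  using assms(2,3) unfolding depends_def
  by (induction rule: rtrancl_induct) (use assms(1) in \<open>auto simp: input_closed_def\<close>)

section \<open>Structure of a well-formed DAG\<close>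

locale abc_dag =
  fixes ms :: "'pk msg list"
  assumes wf: "wf_dag ms"
begin

lemma length_pos: "0 < length ms"
  using wf by (auto simp: wf_dag_def)

lemma genesis_msg: "\<exists>os. ms ! 0 = Genesis os"
  using wf by (auto simp: wf_dag_def)

lemma ins_genesis [simp]: "ins ms 0 = {}"
  using genesis_msg by (auto simp: ins_def)

lemma ref_less: "(a, b) \<in> ref_rel ms \<Longrightarrow> b < a"
  using wf unfolding ref_rel_def wf_dag_def by (cases "ms ! a") fastforce+

lemma past_bound:
  assumes "j \<in> past ms A"
  obtains a where "a \<in> A" "j \<le> a"
proof -
  from assms obtain x where x: "x \<in> A" "(x, j) \<in> (ref_rel ms)\<^sup>*" by (auto simp: past_def)
  from x(2) have "j \<le> x" by (induction rule: rtrancl_induct) (use ref_less in force)+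
  with x(1) that show thesis by blast
qed

lemma genesis_past:
  assumes "A \<noteq> {}" "A \<subseteq> {..<length ms}"
  shows "0 \<in> past ms A"
proof -
  obtain a where a: "a \<in> A" "a < length ms" using assms by auto
  then have "0 \<in> past ms {a}" using wf by (simp add: wf_dag_def)
  moreover have "past ms {a} \<subseteq> past ms A" using a past_self by (intro past_mono) simp
  ultimately show ?thesis by blast
qed

lemma finite_ins: "finite (ins ms i)"
  using wf unfolding wf_dag_def ins_def by (cases "ms ! i") auto

lemma ins_output: "u \<in> ins ms i \<Longrightarrow> is_output ms u \<and> fst u < i"
  using wf unfolding wf_dag_def ins_def by (cases "ms ! i") (auto split: if_splits)

lemma outs_nonneg: "i < length ms \<Longrightarrow> x \<in> set (outs_of (ms ! i)) \<Longrightarrow> 0 \<le> fst x"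
  using wf by (simp add: wf_dag_def)

lemma out_val_nonneg: "is_output ms u \<Longrightarrow> 0 \<le> out_val ms u"
  using outs_nonneg[OF _ nth_mem] by (simp add: is_output_def out_val_def)

lemma val_in_nonneg: "is_output ms u \<Longrightarrow> 0 \<le> val_in ms K u"
  using out_val_nonneg by (simp add: val_in_def)

lemma total_nonneg: "0 \<le> total ms"
  unfolding total_def using outs_nonneg[OF length_pos] by (auto intro!: sum_list_nonneg)

lemma is_tx_cases:
  assumes "is_tx ms i" "i \<noteq> 0"
  obtains I os v where "ms ! i = Tx I os v"
  using assms wf by (cases "ms ! i") (auto simp: is_tx_def wf_dag_def)

lemma is_tx_genesis: "is_tx ms 0"
  using genesis_msg length_pos by (auto simp: is_tx_def)

lemma conf_is_tx: "conf ms D t \<Longrightarrow> is_tx ms t \<and> t \<in> D"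
  by (induction rule: conf.induct) (auto simp: is_tx_genesis)

section \<open>Value balance of a ledger\<close>

lemma outputs_Sigma:
  "X \<subseteq> {..<length ms} \<Longrightarrow> outputs ms X = Sigma X (\<lambda>i. {..<length (outs_of (ms ! i))})"
  by (auto simp: outputs_def is_output_def)

lemma finite_outputs: "finite (outputs ms X)"
proof -
  have "outputs ms X \<subseteq> Sigma {..<length ms} (\<lambda>i. {..<length (outs_of (ms ! i))})"
    by (auto simp: outputs_def is_output_def)
  then show ?thesis by (rule finite_subset) auto
qed

lemma finite_unspent: "finite (unspent ms X)"
  using finite_outputs by (auto simp: unspent_def)

text \<open>Each transaction contributes what it creates minus what it consumes. Input closure puts
  every consumed output among the created ones, and conflict-freeness ensures that none is
  subtracted twice.\<close>

lemma sum_unspent: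
  assumes "X \<subseteq> {..<length ms}" "input_closed ms X" "conflict_free ms X"
  shows "sum (val_in ms K) (unspent ms X) =
    (\<Sum>i\<in>X. (\<Sum>k<length (outs_of (ms ! i)). val_in ms K (i, k)) - sum (val_in ms K) (ins ms i))"
proof -
  have fin: "finite X" using assms(1) finite_subset by blast
  have sub: "(\<Union>i\<in>X. ins ms i) \<subseteq> outputs ms X"
    using assms(2) ins_output by (auto simp: input_closed_def outputs_def)
  have "sum (val_in ms K) (unspent ms X) =
      sum (val_in ms K) (outputs ms X) - sum (val_in ms K) (\<Union>i\<in>X. ins ms i)"
    unfolding unspent_def by (rule sum_diff[OF finite_outputs sub])
  also have "sum (val_in ms K) (\<Union>i\<in>X. ins ms i) = (\<Sum>i\<in>X. sum (val_in ms K) (ins ms i))"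
    using assms(3) by (intro sum.UNION_disjoint fin) (auto simp: finite_ins conflict_free_def)
  also have "sum (val_in ms K) (outputs ms X) =
      (\<Sum>i\<in>X. \<Sum>k<length (outs_of (ms ! i)). val_in ms K (i, k))"
    unfolding outputs_Sigma[OF assms(1)] using fin by (subst sum.Sigma) auto
  finally show ?thesis by (simp add: sum_subtractf)
qed

lemma sum_outs:
  "(\<Sum>k<length (outs_of (ms ! i)). val_in ms K (i, k)) =
   (\<Sum>x\<leftarrow>outs_of (ms ! i). if snd (snd x) \<in> K then fst x else 0)"
  by (auto simp: sum_list_sum_nth val_in_def out_del_def out_val_def atLeast0LessThan intro!: sum.cong)

text \<open>All outputs of an ordinary transaction share its validator, so its value, which equals
  that of its inputs, counts for \<open>K\<close> entirely or not at all.\<close>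

lemma tx_outs:
  assumes "ms ! i = Tx I os v" "i < length ms"
  shows "(\<Sum>k<length (outs_of (ms ! i)). val_in ms K (i, k)) =
    (if v \<in> K then sum (out_val ms) (ins ms i) else 0)"
proof -
  have "sum (out_val ms) I = (\<Sum>x\<leftarrow>os. fst x)"
    using wf assms by (auto simp: wf_dag_def)
  moreover have "(\<Sum>x\<leftarrow>outs_of (ms ! i). if snd (snd x) \<in> K then fst x else 0) =
     (if v \<in> K then (\<Sum>x\<leftarrow>os. fst x) else 0)"
    using assms by (auto simp: comp_def case_prod_beta)
  ultimately show ?thesis using assms unfolding sum_outs by (simp add: ins_def)
qed

text \<open>By conservation of value, no transaction other than the genesis changes the
  balance.\<close>

lemma sum_unspent_total:
  assumes "\<forall>i\<in>X. is_tx ms i" "0 \<in> X" "input_closed ms X" "conflict_free ms X"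
  shows "sum (out_val ms) (unspent ms X) = total ms"
proof -
  have X: "X \<subseteq> {..<length ms}" using assms(1) by (auto simp: is_tx_def)
  have fin: "finite X" using X finite_subset by blast
  let ?f = "\<lambda>i. (\<Sum>k<length (outs_of (ms ! i)). val_in ms UNIV (i, k)) - sum (val_in ms UNIV) (ins ms i)"
  have v: "val_in ms UNIV = out_val ms" by (auto simp: val_in_def)
  have "?f i = 0" if i: "i \<in> X - {0}" for i
  proof -
    obtain I os v where "ms ! i = Tx I os v" using is_tx_cases assms(1) i by blast
    then show ?thesis using tx_outs[of i I os v UNIV] X i by (auto simp: v)
  qed
  then have "sum ?f X = ?f 0" using sum.remove[OF fin assms(2), of ?f] by simp
  moreover have "?f 0 = total ms" unfolding sum_outs by (simp add: total_def)
  ultimately show ?thesis using sum_unspent[OF X assms(3,4), of UNIV] by (simp add: v)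
qed

text \<open>Comparison transaction by transaction. One with an adversarial validator adds its
  honest-delegated inputs to the balance, and \<open>adv_count\<close> adds these at issuance, also
  outside \<open>X\<close>. One with an honest validator removes its adversary-delegated inputs, and
  \<open>adv_count\<close> subtracts these only upon confirmation, hence only inside
  \<open>X\<close>.\<close>

lemma adv_count_ge:
  assumes X: "\<forall>i\<in>X. is_tx ms i" "X \<subseteq> {..<m}" "0 \<in> X" "input_closed ms X" "conflict_free ms X"
    and conf: "\<And>i. conf ms {..<m} i \<Longrightarrow> i \<in> X"
    and "m \<le> length ms"
  shows "sum (val_in ms (- Hon)) (unspent ms X) \<le> adv_count Hon ms m"
proof -
  have fin: "finite X" using X(2) finite_subset by blast
  let ?f = "\<lambda>i. (\<Sum>k<length (outs_of (ms ! i)). val_in ms (- Hon) (i, k)) - sum (val_in ms (- Hon)) (ins ms i)"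
  let ?a = "\<lambda>i. \<Sum>u\<in>{u \<in> ins ms i. out_del ms u \<in> Hon}. out_val ms u"
  let ?h = "\<lambda>i. \<Sum>u\<in>{u \<in> ins ms i. out_del ms u \<notin> Hon}. out_val ms u"
  define TA where "TA = {i. i < m \<and> (\<exists>I os v. ms ! i = Tx I os v \<and> v \<notin> Hon)}"
  define TH where "TH = {i. i < m \<and> (\<exists>I os v. ms ! i = Tx I os v \<and> v \<in> Hon)}"
  define TC where "TC = {i. i < m \<and> (\<exists>I os v. ms ! i = Tx I os v \<and> v \<in> Hon) \<and> conf ms {..<m} i}"
  have fins: "finite TA" "finite TH" "finite TC" by (auto simp: TA_def TH_def TC_def)
  have nonneg: "0 \<le> ?a i" "0 \<le> ?h i" for i
    using ins_output out_val_nonneg by (auto intro!: sum_nonneg)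
  have h: "sum (val_in ms (- Hon)) (ins ms i) = ?h i" for i
    unfolding val_in_def using finite_ins[of i] by (simp add: sum.If_cases Int_def)
  have split: "sum (out_val ms) (ins ms i) = ?a i + ?h i" for i
    by (subst sum.union_disjoint[symmetric]) (auto simp: finite_ins intro!: sum.cong)
  have lt: "i < length ms" if "i \<in> X" for i using that X(1) by (auto simp: is_tx_def)
  have fA: "?f i = ?a i" if i: "i \<in> X \<inter> TA" for i
  proof -
    obtain I os v where "ms ! i = Tx I os v" "v \<notin> Hon" using i by (auto simp: TA_def)
    then show ?thesis using tx_outs[of i I os v "- Hon"] lt i split[of i] h[of i] by auto
  qed
  have fH: "?f i = - ?h i" if i: "i \<in> X \<inter> TH" for i
  proof -
    obtain I os v where "ms ! i = Tx I os v" "v \<in> Hon" using i by (auto simp: TH_def)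
    then show ?thesis using tx_outs[of i I os v "- Hon"] lt i h[of i] by auto
  qed
  have zero: "0 \<notin> TA" "0 \<notin> TH" using genesis_msg by (auto simp: TA_def TH_def)
  have disj: "TA \<inter> TH = {}" by (auto simp: TA_def TH_def)
  have cover: "X = {0} \<union> (X \<inter> TA) \<union> (X \<inter> TH)"
  proof -
    have "i = 0 \<or> i \<in> TA \<or> i \<in> TH" if i: "i \<in> X" for i
    proof (cases "i = 0")
      case False
      then obtain I os v where "ms ! i = Tx I os v" using is_tx_cases X(1) i by blast
      then show ?thesis using i X(2) by (auto simp: TA_def TH_def)
    qed simp
    then show ?thesis using X(3) by blast
  qed
  have "sum ?f X = sum ?f ({0} \<union> (X \<inter> TA) \<union> (X \<inter> TH))" using cover by simp
  also have "\<dots> = ?f 0 + sum ?f (X \<inter> TA) + sum ?f (X \<inter> TH)"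
    using fin zero disj by (subst sum.union_disjoint; auto)+
  also have "sum ?f (X \<inter> TA) = sum ?a (X \<inter> TA)" using fA by (rule sum.cong[OF refl])
  also have "sum ?f (X \<inter> TH) = - sum ?h (X \<inter> TH)"
    using fH by (simp add: sum_negf[symmetric])
  also have "sum ?a (X \<inter> TA) \<le> sum ?a TA" using fins nonneg by (intro sum_mono2) auto
  also have "- sum ?h (X \<inter> TH) \<le> - sum ?h TC"
  proof -
    have "TC \<subseteq> X \<inter> TH" using conf by (auto simp: TC_def TH_def)
    then have "sum ?h TC \<le> sum ?h (X \<inter> TH)" using fin nonneg by (intro sum_mono2) auto
    then show ?thesis by simp
  qed
  also have "?f 0 = (\<Sum>x\<leftarrow>outs_of (ms ! 0). if snd (snd x) \<notin> Hon then fst x else 0)"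
    unfolding sum_outs by simp
  finally have "sum ?f X \<le> adv_count Hon ms m"
    unfolding adv_count_def TA_def[symmetric] TC_def[symmetric] by simp
  moreover have "X \<subseteq> {..<length ms}" using lt by auto
  ultimately show ?thesis using sum_unspent[OF _ X(4,5)] by simp
qed

section \<open>Quorum stakes and the certificates behind confirmations\<close>

lemma finite_signers: "finite (signers ms A t)"
proof -
  have "signers ms A t \<subseteq> (\<lambda>a. case ms ! a of Ack v p T \<Rightarrow> v | _ \<Rightarrow> undefined) ` {..<length ms}"
    unfolding signers_def by force
  then show ?thesis by (rule finite_subset) simp
qed

text \<open>An output names one validator, so the stakes of a quorum come from disjoint sets of
  outputs and merge into one sum.\<close>

lemma sum_stake:
  "(\<Sum>v\<in>signers ms A t. stake ms C P v) =
   sum (out_val ms) {u. is_output ms u \<and> fst u \<in> P \<and> fst u \<in> C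
     \<and> out_del ms u \<in> signers ms A t \<and> \<not> spent_in ms P u}"
proof -
  let ?U = "\<lambda>v. {u. is_output ms u \<and> fst u \<in> P \<and> fst u \<in> C \<and> out_del ms u = v \<and> \<not> spent_in ms P u}"
  have "finite (?U v)" for v
    by (rule finite_subset[OF _ finite_outputs[of P]]) (auto simp: outputs_def)
  then have "(\<Sum>v\<in>signers ms A t. stake ms C P v) = sum (out_val ms) (\<Union>v\<in>signers ms A t. ?U v)"
    unfolding stake_def by (subst sum.UNION_disjoint) (auto simp: finite_signers)
  also have "(\<Union>v\<in>signers ms A t. ?U v) = {u. is_output ms u \<and> fst u \<in> P \<and> fst u \<in> C
     \<and> out_del ms u \<in> signers ms A t \<and> \<not> spent_in ms P u}" by auto
  finally show ?thesis .
qed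

lemma stake_mono: "C \<subseteq> C' \<Longrightarrow> stake ms C P v \<le> stake ms C' P v"
  unfolding stake_def
proof (rule sum_mono2)
  show "finite {u. is_output ms u \<and> fst u \<in> P \<and> fst u \<in> C' \<and> out_del ms u = v \<and> \<not> spent_in ms P u}"
    by (rule finite_subset[OF _ finite_outputs[of P]]) (auto simp: outputs_def)
qed (auto simp: out_val_nonneg)

lemma cert_is_tx: "cert ms k t A \<Longrightarrow> is_tx ms t"
  by (cases k) auto

lemma cert_ack: "cert ms k t A \<Longrightarrow> a \<in> A \<Longrightarrow> is_ack ms a"
  by (cases k) auto

lemma cert_exclusive:
  "cert ms k t A \<Longrightarrow> j \<in> past ms A \<Longrightarrow> is_tx ms j \<Longrightarrow> j \<noteq> t \<Longrightarrow> ins ms j \<inter> ins ms t = {}"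
  by (cases k) auto

text \<open>The total is nonnegative, so exceeding the quorum threshold takes at least one signer,
  whose ack references \<open>t\<close>.\<close>

lemma cert_past: "cert ms k t A \<Longrightarrow> t \<in> past ms A"
proof (cases k)
  case (Suc k')
  assume "cert ms k t A"
  then obtain C where "(\<Sum>v\<in>signers ms A t. stake ms C (past ms A) v) > 2/3 * total ms"
    using Suc by auto
  then have "signers ms A t \<noteq> {}" using total_nonneg by auto
  then obtain v where "v \<in> signers ms A t" by blast
  then show ?thesis by (rule signer_past)
qed simp

lemma ack_not_tx: "is_ack ms i \<Longrightarrow> \<not> is_tx ms i"
  by (cases "ms ! i") (auto simp: is_ack_def is_tx_def)

text \<open>Translates the inductive \<open>conf\<close> into ranked certificates. Since
  \<open>cert\<close> does not ask for confirmed producers, the set \<open>C\<close> carries the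
  ancestors of \<open>t\<close> along, each but the genesis with a certificate of its own.\<close>

lemma conf_certs:
  assumes "conf ms D t"
  shows "\<exists>k C. t \<in> C \<and> input_closed ms C \<and> (\<forall>c\<in>C. c = 0 \<or> (\<exists>A\<subseteq>D. cert ms k c A))"
  using assms
proof induction
  case (genesis D)
  show ?case by (rule exI[of _ 0], rule exI[of _ "{0}"]) (auto simp: input_closed_def)
next
  case (step t D A C)
  let ?P = "\<lambda>D c k. \<exists>X. c \<in> X \<and> input_closed ms X \<and> (\<forall>c\<in>X. c = 0 \<or> (\<exists>A\<subseteq>D. cert ms k c A))"
  have mono: "?P D c k'" if "k \<le> k'" "?P D c k" for D c k k'
    using that cert_mono[OF that(1)] by meson
  have "C \<subseteq> {..<length ms}" using step.IH(2) conf_is_tx unfolding is_tx_def by blast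
  then have "finite C" using finite_subset by blast
  then have "\<exists>k. \<forall>c\<in>C. ?P (past ms A) c k"
  proof (rule bounded_uniform)
    show "\<forall>c\<in>C. \<exists>k. ?P (past ms A) c k" using step.IH(2) by simp
  qed (rule mono)
  then obtain k X where X: "\<forall>c\<in>C. c \<in> X c \<and> input_closed ms (X c)
      \<and> (\<forall>d\<in>X c. d = 0 \<or> (\<exists>A'\<subseteq>past ms A. cert ms k d A'))" by metis
  have cl: "input_closed ms (\<Union>c\<in>C. X c)" using X unfolding input_closed_def by blast
  have ce: "\<forall>d\<in>(\<Union>c\<in>C. X c). d = 0 \<or> (\<exists>A'\<subseteq>past ms A. cert ms k d A')" using X by blast
  \<comment> \<open>Enlarging the counted set to the input-closed union can only raise the stake,
    values being nonnegative.\<close>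
  have "(\<Sum>v\<in>signers ms A t. stake ms C (past ms A) v)
      \<le> (\<Sum>v\<in>signers ms A t. stake ms (\<Union>c\<in>C. X c) (past ms A) v)"
    using X by (intro sum_mono stake_mono) blast
  then have "(\<Sum>v\<in>signers ms A t. stake ms (\<Union>c\<in>C. X c) (past ms A) v) > 2/3 * total ms"
    using step.hyps by linarith
  then have cert: "cert ms (Suc k) t A" using step.hyps cl ce by (intro certI) auto
  have "finite (fst ` ins ms t)" using finite_ins by blast
  then have "\<exists>k. \<forall>c\<in>fst ` ins ms t. ?P D c k"
  proof (rule bounded_uniform)
    show "\<forall>c\<in>fst ` ins ms t. \<exists>k. ?P D c k" using step.IH(1) by simp
  qed (rule mono)
  then obtain l Y where Y: "\<forall>c\<in>fst ` ins ms t. c \<in> Y c \<and> input_closed ms (Y c)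
      \<and> (\<forall>d\<in>Y c. d = 0 \<or> (\<exists>A'\<subseteq>D. cert ms l d A'))" by metis
  let ?Y = "insert t (\<Union>c\<in>fst ` ins ms t. Y c)" and ?k = "max (Suc k) l"
  have "input_closed ms ?Y" using Y unfolding input_closed_def by blast
  moreover have "d = 0 \<or> (\<exists>A'\<subseteq>D. cert ms ?k d A')" if "d \<in> ?Y" for d
  proof (cases "d = t")
    case True
    then show ?thesis using cert_mono[OF _ cert, of ?k] step.hyps by auto
  next
    case False
    then show ?thesis using that Y cert_mono[of l ?k] by (metis insertE UN_E max.cobounded2)
  qed
  ultimately show ?case by blast
qed

end

section \<open>Honest validators and their chains of acks\<close>

locale abc_execution = abc_dag ms for ms :: "'pk msg list" +
  fixes Hon :: "'pk set"
  assumes honest: "honest_validators Hon ms"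
    and bound: "adv_bound Hon ms"
begin

text \<open>Strong induction on \<open>b\<close>: its reference to the previous ack points to the
  greatest earlier ack of \<open>v\<close>, whose index is at least \<open>a\<close>.\<close>

lemma honest_chain:
  assumes "v \<in> Hon" "ack_by ms v a" "ack_by ms v b" "a \<le> b"
  shows "a \<in> past ms {b}"
  using assms(3,4)
proof (induction b rule: less_induct)
  case (less b)
  have b: "b < length ms" using less.prems by (simp add: ack_by_def)
  show ?case
  proof (cases "a = b")
    case True
    then show ?thesis using b past_self by blast
  next
    case False
    let ?Q = "\<lambda>j. j < b \<and> ack_by ms v j"
    let ?g = "GREATEST j. ?Q j"
    have Qa: "?Q a" using False less.prems assms(2) by simp
    have bd: "\<And>y. ?Q y \<Longrightarrow> y \<le> b" by simp
    have g: "?Q ?g" "a \<le> ?g"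
      using GreatestI_nat[of ?Q a b, OF Qa bd] Greatest_le_nat[of ?Q a b, OF Qa bd] by auto
    obtain p T where pT: "ms ! b = Ack v p T" using less.prems by (auto simp: ack_by_def)
    have "p = (if \<exists>j < b. ack_by ms v j then Some ?g else None)"
      using honest b pT assms(1) unfolding honest_validators_def by blast
    then have "p = Some ?g" using Qa by auto
    then have "(b, ?g) \<in> ref_rel ms" using pT b by (auto simp: ref_rel_def)
    then have "?g \<in> past ms {b}" using b by (auto simp: past_def)
    moreover have "a \<in> past ms {?g}" using less.IH[of ?g] g by blast
    ultimately show ?thesis using past_mono[of "{?g}" ms "{b}"] by blast
  qed
qed

text \<open>The later of the two acks of \<open>v\<close> reaches the earlier one through the chain,
  and with it the transaction signed there.\<close>

lemma honest_signer_ordered: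
  assumes "v \<in> Hon" "v \<in> signers ms A1 t1" "v \<in> signers ms A2 t2"
  shows "t1 \<in> past ms A2 \<or> t2 \<in> past ms A1"
proof -
  obtain a1 p1 T1 where 1: "a1 \<in> A1" "a1 < length ms" "ms ! a1 = Ack v p1 T1" "t1 \<in> T1"
    using assms(2) by (auto simp: signers_def)
  obtain a2 p2 T2 where 2: "a2 \<in> A2" "a2 < length ms" "ms ! a2 = Ack v p2 T2" "t2 \<in> T2"
    using assms(3) by (auto simp: signers_def)
  have ab: "ack_by ms v a1" "ack_by ms v a2" using 1 2 by (auto simp: ack_by_def)
  have r: "t1 \<in> past ms {a1}" "t2 \<in> past ms {a2}"
    using 1 2 by (auto intro!: signer_past[of v] simp: signers_def)
  have s: "past ms {a1} \<subseteq> past ms A1" "past ms {a2} \<subseteq> past ms A2"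
    using 1 2 by (auto simp: past_def)
  show ?thesis
  proof (cases "a1 \<le> a2")
    case True
    then have "a1 \<in> past ms {a2}" using honest_chain assms(1) ab by blast
    then show ?thesis using past_mono[of "{a1}" ms "{a2}"] r s by blast
  next
    case False
    then have "a2 \<in> past ms {a1}" using honest_chain assms(1) ab by simp
    then show ?thesis using past_mono[of "{a2}" ms "{a1}"] r s by blast
  qed
qed

section \<open>The ordering of certificates\<close>

lemma certs_disjoint:
  assumes "ordered_at ms w1 w2" "bounded_cert ms w1 c A" "bounded_cert ms w2 d B" "c \<noteq> d"
  shows "ins ms c \<inter> ins ms d = {}"
proof -
  have c: "cert ms (snd w1) c A" and d: "cert ms (snd w2) d B"
    using assms by (auto simp: bounded_cert_def)
  have "c \<in> past ms B \<or> d \<in> past ms A" using assms(1-3) by (rule ordered_atD)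
  then show ?thesis
    using cert_exclusive[OF c, of d] cert_exclusive[OF d, of c] cert_is_tx[OF c] cert_is_tx[OF d] assms(4)
    by blast
qed

text \<open>\<open>left\<close> and \<open>right\<close> compare a counted transaction with the
  opposite certificate, which puts it in both pasts. \<open>below\<close> compares two smaller
  certificates: it excludes double spends among counted transactions and later orders the spender
  \<open>r\<close> against \<open>c\<close>.\<close>

lemma ordered_at_step:
  assumes below: "\<And>u1 u2. u1 < max w1 w2 \<Longrightarrow> u2 < max w1 w2 \<Longrightarrow> ordered_at ms u1 u2"
    and left: "\<And>u. u < w1 \<Longrightarrow> ordered_at ms u w2"
    and right: "\<And>u. u < w2 \<Longrightarrow> ordered_at ms w1 u"
  shows "ordered_at ms w1 w2"
  unfolding ordered_at_def
proof (intro allI impI, rule ccontr)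
  fix t1 A1 t2 A2
  assume b1: "bounded_cert ms w1 t1 A1" and b2: "bounded_cert ms w2 t2 A2"
    and bad: "\<not> (t1 \<in> past ms A2 \<or> t2 \<in> past ms A1)"
  define P1 where "P1 = past ms A1"
  define P2 where "P2 = past ms A2"
  \<comment> \<open>Rank 0 admits no certificate, so both ranks are successors.\<close>
  obtain n1 k1 where w1: "w1 = (n1, Suc k1)"
    using b1 by (cases w1; cases "snd w1") (auto simp: bounded_cert_def)
  obtain n2 k2 where w2: "w2 = (n2, Suc k2)"
    using b2 by (cases w2; cases "snd w2") (auto simp: bounded_cert_def)
  have c1: "cert ms (Suc k1) t1 A1" "A1 \<subseteq> {..<n1}" using b1 w1 by (auto simp: bounded_cert_def)
  have c2: "cert ms (Suc k2) t2 A2" "A2 \<subseteq> {..<n2}" using b2 w2 by (auto simp: bounded_cert_def)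
  obtain C1 where C1: "input_closed ms C1" "\<forall>c\<in>C1. c = 0 \<or> (\<exists>A'\<subseteq>P1. cert ms k1 c A')"
    "(\<Sum>v\<in>signers ms A1 t1. stake ms C1 P1 v) > 2/3 * total ms" using c1 by (auto simp: P1_def)
  obtain C2 where C2: "input_closed ms C2" "\<forall>c\<in>C2. c = 0 \<or> (\<exists>A'\<subseteq>P2. cert ms k2 c A')"
    "(\<Sum>v\<in>signers ms A2 t2. stake ms C2 P2 v) > 2/3 * total ms" using c2 by (auto simp: P2_def)
  have P_lt: "P1 \<subseteq> {..<n1}" "P2 \<subseteq> {..<n2}"
    using c1(2) c2(2) past_bound unfolding P1_def P2_def
    by (metis lessThan_iff order_le_less_trans subsetD subsetI)+
  \<comment> \<open>Counted transactions have certificates inside \<open>P1\<close> or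
    \<open>P2\<close>, hence with the same ack bound and a rank lower by one.\<close>
  have lt: "(n1, k1) < w1" "(n2, k2) < w2" by (auto simp: w1 w2)
  have lt_max: "(n1, k1) < max w1 w2" "(n2, k2) < max w1 w2" using lt by (auto simp: less_max_iff_disj)
  have zero: "0 \<in> P1" "0 \<in> P2"
  proof -
    have "A1 \<noteq> {}" "A2 \<noteq> {}" using cert_past[OF c1(1)] cert_past[OF c2(1)] by (auto simp: past_def)
    moreover have "A1 \<subseteq> {..<length ms}" "A2 \<subseteq> {..<length ms}"
      using cert_ack c1(1) c2(1) unfolding is_ack_def by blast+
    ultimately show "0 \<in> P1" "0 \<in> P2" using genesis_past by (auto simp: P1_def P2_def)
  qed
  have C1P: "C1 \<subseteq> P1 \<inter> P2"
  proof
    fix c assume "c \<in> C1"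
    then consider "c = 0" | A where "A \<subseteq> P1" "cert ms k1 c A" using C1(2) by meson
    then show "c \<in> P1 \<inter> P2"
    proof cases
      case 2
      have sub: "past ms A \<subseteq> P1" using 2(1) past_mono[of A ms A1] by (simp add: P1_def)
      have "bounded_cert ms (n1, k1) c A" using 2 P_lt by (auto simp: bounded_cert_def)
      \<comment> \<open>The second alternative would put \<open>t2\<close> in \<open>P1\<close>,
        against \<open>bad\<close>.\<close>
      then have "c \<in> P2 \<or> t2 \<in> past ms A"
        using ordered_atD[OF left[OF lt(1)] _ b2] unfolding P2_def by blast
      then show ?thesis using sub bad cert_past[OF 2(2)] by (auto simp: P1_def)
    qed (simp add: zero)
  qed
  have C2P: "C2 \<subseteq> P1 \<inter> P2"
  proof
    fix c assume "c \<in> C2"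
    then consider "c = 0" | A where "A \<subseteq> P2" "cert ms k2 c A" using C2(2) by meson
    then show "c \<in> P1 \<inter> P2"
    proof cases
      case 2
      have sub: "past ms A \<subseteq> P2" using 2(1) past_mono[of A ms A2] by (simp add: P2_def)
      have "bounded_cert ms (n2, k2) c A" using 2 P_lt by (auto simp: bounded_cert_def)
      then have "t1 \<in> past ms A \<or> c \<in> P1"
        using ordered_atD[OF right[OF lt(2)] b1] unfolding P1_def by blast
      then show ?thesis using sub bad cert_past[OF 2(2)] by (auto simp: P2_def)
    qed (simp add: zero)
  qed
  \<comment> \<open>The common ledger of both quorums: as \<open>F\<close> lies in both pasts,
    whatever is unspent in \<open>P1\<close> or in \<open>P2\<close> is unspent in
    \<open>F\<close>.\<close>
  define F where "F = insert 0 (C1 \<union> C2)"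
  have F_P: "F \<subseteq> P1 \<inter> P2" using C1P C2P zero by (auto simp: F_def)
  have F_closed: "input_closed ms F" using C1(1) C2(1) by (auto simp: F_def input_closed_def)
  have F_cert: "c = 0 \<or> (\<exists>u A. u < max w1 w2 \<and> bounded_cert ms u c A)" if "c \<in> F" for c
  proof -
    have "c = 0 \<or> (\<exists>A\<subseteq>P1. cert ms k1 c A) \<or> (\<exists>A\<subseteq>P2. cert ms k2 c A)"
      using that C1(2) C2(2) by (auto simp: F_def)
    moreover have "bounded_cert ms (n1, k1) c A" if "A \<subseteq> P1" "cert ms k1 c A" for A
      using that P_lt by (auto simp: bounded_cert_def)
    moreover have "bounded_cert ms (n2, k2) c A" if "A \<subseteq> P2" "cert ms k2 c A" for A
      using that P_lt by (auto simp: bounded_cert_def)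
    ultimately show ?thesis using lt_max by meson
  qed
  \<comment> \<open>Stated for arbitrary \<open>X\<close>, as it serves both \<open>F\<close> and
    the ledger at time \<open>m\<close>.\<close>
  have cf: "conflict_free ms X"
    if X: "\<And>c. c \<in> X \<Longrightarrow> c = 0 \<or> (\<exists>u A. u < max w1 w2 \<and> bounded_cert ms u c A)" for X
    unfolding conflict_free_def
  proof (intro ballI impI)
    fix i j assume ij: "i \<in> X" "j \<in> X" "i \<noteq> j"
    show "ins ms i \<inter> ins ms j = {}"
    proof (cases "i = 0 \<or> j = 0")
      case False
      then show ?thesis using X[OF ij(1)] X[OF ij(2)] ij(3) below certs_disjoint by meson
    qed auto
  qed
  have tx: "is_tx ms c" if "c = 0 \<or> (\<exists>u A. u < max w1 w2 \<and> bounded_cert ms u c A)" for c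
    using that cert_is_tx is_tx_genesis by (auto simp: bounded_cert_def)
  define O1 where "O1 = {u. is_output ms u \<and> fst u \<in> P1 \<and> fst u \<in> C1
     \<and> out_del ms u \<in> signers ms A1 t1 \<and> \<not> spent_in ms P1 u}"
  define O2 where "O2 = {u. is_output ms u \<and> fst u \<in> P2 \<and> fst u \<in> C2
     \<and> out_del ms u \<in> signers ms A2 t2 \<and> \<not> spent_in ms P2 u}"
  define B where "B = O1 \<inter> O2"
  have O_sub: "O1 \<union> O2 \<subseteq> unspent ms F"
    using F_P unfolding O1_def O2_def F_def unspent_def outputs_def spent_in_def by blast
  then have fin: "finite O1" "finite O2" using finite_unspent finite_subset by blast+
  have "sum (out_val ms) (O1 \<union> O2) \<le> sum (out_val ms) (unspent ms F)"
    by (rule sum_mono2[OF finite_unspent O_sub]) (auto simp: unspent_def outputs_def out_val_nonneg)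
  also have "\<dots> = total ms"
  proof (rule sum_unspent_total)
    show "\<forall>i\<in>F. is_tx ms i" using tx[OF F_cert] by blast
    show "conflict_free ms F" by (rule cf) (rule F_cert)
  qed (use F_closed in \<open>auto simp: F_def\<close>)
  finally have "sum (out_val ms) (O1 \<union> O2) \<le> total ms" .
  moreover have "sum (out_val ms) O1 > 2/3 * total ms" "sum (out_val ms) O2 > 2/3 * total ms"
    using C1(3) C2(3) unfolding sum_stake O1_def O2_def by auto
  \<comment> \<open>Inclusion-exclusion: 2/3 + 2/3 - 1 = 1/3.\<close>
  ultimately have B_large: "sum (out_val ms) B > total ms / 3"
    using sum.union_inter[OF fin, of "out_val ms"] by (simp add: B_def)
  have B_adv: "out_del ms u \<notin> Hon" if "u \<in> B" for u
    using that honest_signer_ordered bad unfolding B_def O1_def O2_def by blast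

  have B_ne: "B \<noteq> {}" using B_large total_nonneg by auto
  have finB: "finite B" using fin by (simp add: B_def)
  define c where "c = Max (fst ` B)"
  have "c \<in> fst ` B" using B_ne finB by (simp add: c_def)
  then have cC: "c \<in> C1" by (auto simp: B_def O1_def)
  have c_max: "fst u \<le> c" if "u \<in> B" for u using that finB by (simp add: c_def)
  \<comment> \<open>The prefix ending with \<open>c\<close>: all outputs in \<open>B\<close> have
    been issued by then, but no ack in it can reference \<open>c\<close> yet.\<close>
  define m where "m = Suc c"
  have c_tx: "is_tx ms c" using cC tx F_cert by (auto simp: F_def)
  \<comment> \<open>An ack in \<open>A1\<close> that reaches \<open>c\<close> is not
    \<open>c\<close> itself, hence strictly later. Certificates in the prefix \<open>m\<close> thus
    weigh less than \<open>w1\<close> at any rank.\<close>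
  have m_lt: "m < n1"
  proof -
    obtain a where a: "a \<in> A1" "c \<le> a" using cC C1P past_bound[of c A1] by (auto simp: P1_def)
    have "c \<noteq> a" using c_tx ack_not_tx cert_ack[OF c1(1) a(1)] by blast
    then show ?thesis using a c1(2) by (auto simp: m_def)
  qed
  have m_w: "(m, j) < max w1 w2" for j using m_lt by (auto simp: w1 less_max_iff_disj)
  define G where "G = {i. conf ms {..<m} i}"
  \<comment> \<open>The producers of \<open>B\<close> may be confirmed only after \<open>m\<close>
    and so be missing from \<open>G\<close>; the early part of \<open>F\<close> supplies
    them.\<close>
  define X where "X = G \<union> {i \<in> F. i < m}"
  have G_cert: "i = 0 \<or> (\<exists>k A. bounded_cert ms (m, k) i A)" if "i \<in> G" for i
    using conf_certs[of "{..<m}" i] that by (auto simp: G_def bounded_cert_def)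
  have X_cert: "i = 0 \<or> (\<exists>u A. u < max w1 w2 \<and> bounded_cert ms u i A)" if "i \<in> X" for i
    using that G_cert F_cert m_w unfolding X_def by blast
  have G_closed: "input_closed ms G"
    unfolding input_closed_def
  proof
    fix i assume "i \<in> G"
    then have "conf ms {..<m} i" by (simp add: G_def)
    then show "fst ` ins ms i \<subseteq> G" by cases (auto simp: G_def)
  qed
  have X_closed: "input_closed ms X"
    unfolding input_closed_def
  proof
    fix i assume i: "i \<in> X"
    show "fst ` ins ms i \<subseteq> X"
    proof (cases "i \<in> G")
      case True
      then show ?thesis using G_closed unfolding input_closed_def X_def by blast
    next
      case False
      then have "i \<in> F" "i < m" using i by (auto simp: X_def)
      then have "fst ` ins ms i \<subseteq> F" "\<forall>j\<in>fst ` ins ms i. j < m"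
        using F_closed ins_output[of _ i] unfolding input_closed_def by (blast, force)
      then show ?thesis by (auto simp: X_def)
    qed
  qed
  have X_sub: "X \<subseteq> {..<m}" using conf_is_tx by (auto simp: X_def G_def)
  have m_le: "m \<le> length ms" using c_tx by (simp add: is_tx_def m_def)
  have "sum (val_in ms (- Hon)) (unspent ms X) \<le> adv_count Hon ms m"
  proof (rule adv_count_ge)
    show "\<forall>i\<in>X. is_tx ms i" using tx[OF X_cert] by blast
    show "conflict_free ms X" by (rule cf) (rule X_cert)
  qed (use X_sub X_closed m_le in \<open>auto simp: X_def G_def F_def m_def\<close>)
  also have "\<dots> < total ms / 3" using bound m_le by (simp add: adv_bound_def)
  finally have small: "sum (val_in ms (- Hon)) (unspent ms X) < total ms / 3" .

  have B_F: "\<not> u \<in> ins ms i" if "u \<in> B" "i \<in> P1" for u i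
    using that by (auto simp: B_def O1_def spent_in_def)
  \<comment> \<open>By \<open>below\<close>, \<open>r\<close> and \<open>c\<close> are ordered. The
    certificate of \<open>r\<close> is too early to reach \<open>c\<close>, so \<open>r\<close>
    would lie in \<open>P1\<close>, where \<open>u\<close> is unspent.\<close>
  have B_G: "\<not> u \<in> ins ms r" if u: "u \<in> B" and r: "r \<in> G" for u r
  proof
    assume ur: "u \<in> ins ms r"
    then have "r \<noteq> 0" using ins_genesis by (metis empty_iff)
    then obtain k A where A: "bounded_cert ms (m, k) r A" using G_cert r by blast
    have "r < m" using r X_sub by (auto simp: X_def)
    \<comment> \<open>\<open>c = 0\<close> would give \<open>m = 1\<close> and force
      \<open>r = 0\<close>.\<close>
    then have "c \<noteq> 0" using \<open>r \<noteq> 0\<close> by (simp add: m_def)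
    then obtain A' where A': "A' \<subseteq> P1" "cert ms k1 c A'" using C1(2) cC by meson
    have "bounded_cert ms (n1, k1) c A'" using A' P_lt by (auto simp: bounded_cert_def)
    then have "c \<in> past ms A \<or> r \<in> past ms A'"
      using ordered_atD[OF below[OF lt_max(1) m_w] _ A] by blast
    moreover have "past ms A' \<subseteq> P1" using A'(1) past_mono[of A' ms A1] by (simp add: P1_def)
    then have "r \<notin> past ms A'" using B_F[OF u] ur by blast
    moreover have "c \<notin> past ms A"
    proof
      assume "c \<in> past ms A"
      then obtain a where a: "a \<in> A" "c \<le> a" using past_bound by blast
      \<comment> \<open>Acks in \<open>A\<close> have index below \<open>m = Suc c\<close>, so
        \<open>a\<close> could only be \<open>c\<close>, which is a transaction.\<close>
      then have "a = c" using A by (auto simp: bounded_cert_def m_def)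
      then show False using c_tx ack_not_tx cert_ack[of k r A a] A a(1) by (auto simp: bounded_cert_def)
    qed
    ultimately show False by blast
  qed
  have "B \<subseteq> unspent ms X"
  proof
    fix u assume u: "u \<in> B"
    then have "u \<in> outputs ms X"
      using c_max[OF u] by (auto simp: B_def O1_def outputs_def X_def F_def m_def)
    moreover have "u \<notin> ins ms i" if "i \<in> X" for i
      using that B_F[OF u] B_G[OF u] F_P by (auto simp: X_def)
    ultimately show "u \<in> unspent ms X" by (auto simp: unspent_def)
  qed
  then have "sum (val_in ms (- Hon)) B \<le> sum (val_in ms (- Hon)) (unspent ms X)"
    by (rule sum_mono2[OF finite_unspent]) (auto simp: unspent_def outputs_def val_in_nonneg)
  moreover have "sum (val_in ms (- Hon)) B = sum (out_val ms) B"
    using B_adv by (intro sum.cong) (auto simp: val_in_def)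
  ultimately show False using B_large small by linarith
qed

text \<open>Lowering one weight with the other fixed either lowers the maximum or keeps it and
  lowers the minimum; replacing both by weights below the maximum lowers the maximum.\<close>

lemma ordered_at: "ordered_at ms w1 w2"
proof (induction "(max w1 w2, min w1 w2)" arbitrary: w1 w2 rule: less_induct)
  case less
  show ?case
  proof (rule ordered_at_step)
    fix u1 u2 assume "u1 < max w1 w2" "u2 < max w1 w2"
    then show "ordered_at ms u1 u2" by (intro less) simp
  next
    fix u assume "u < w1"
    then show "ordered_at ms u w2" by (intro less) (auto simp: max_def min_def split: if_splits)
  next
    fix u assume "u < w2"
    then show "ordered_at ms w1 u" by (intro less) (auto simp: max_def min_def split: if_splits)
  qed
qed

section \<open>From ordered certificates to the absence of conflicts\<close>

lemma confirmed_not_conflict: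
  assumes "confirmed ms t1" "confirmed ms t2"
  shows "\<not> conflict ms t1 t2"
proof
  assume "conflict ms t1 t2"
  then obtain s1 s2 where s: "depends ms t1 s1" "depends ms t2 s2" "s1 \<noteq> s2" "ins ms s1 \<inter> ins ms s2 \<noteq> {}"
    by (rule conflict_base)
  \<comment> \<open>An ancestor \<open>r\<close> of \<open>t\<close> lies in the input-closed set
    given by \<open>conf_certs\<close>; having an input, it is not the genesis and so has a
    certificate.\<close>
  have certified: "\<exists>k A. bounded_cert ms (length ms, k) r A"
    if t: "confirmed ms t" "depends ms t r" "ins ms r \<noteq> {}" for t r
  proof -
    obtain k C where "t \<in> C" "input_closed ms C"
      and C: "\<forall>c\<in>C. c = 0 \<or> (\<exists>A\<subseteq>{..<length ms}. cert ms k c A)"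
      using conf_certs[OF t(1)[unfolded confirmed_def]] by meson
    then have "r \<in> C" using input_closed_depends t(2) by blast
    moreover have "r \<noteq> 0" using t(3) ins_genesis by metis
    ultimately obtain A where "A \<subseteq> {..<length ms}" "cert ms k r A" using C by meson
    then have "bounded_cert ms (length ms, k) r A" by (simp add: bounded_cert_def)
    then show ?thesis by blast
  qed
  have "ins ms s1 \<noteq> {}" "ins ms s2 \<noteq> {}" using s(4) by auto
  then obtain k1 A1 k2 A2 where
    "bounded_cert ms (length ms, k1) s1 A1" "bounded_cert ms (length ms, k2) s2 A2"
    using certified[OF assms(1) s(1)] certified[OF assms(2) s(2)] by blast
  then show False using certs_disjoint[OF ordered_at] s(3,4) by blast
qed

end

theorem theorem5:
  fixes Hon :: "'pk set" and ms :: "'pk msg list"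
  assumes "wf_dag ms"
      and "honest_agents Hon ms"
      and "honest_validators Hon ms"
      and "adv_bound Hon ms"
  shows "\<forall>t1 t2. confirmed ms t1 \<and> confirmed ms t2 \<longrightarrow> \<not> conflict ms t1 t2"
proof -
  interpret abc_execution ms Hon
    using assms by unfold_locales
  show ?thesis using confirmed_not_conflict by blast
qed

end
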